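(* Let $\Phi$ be the root system of type $A_n$ with standard positive system $\Phi^+$ and simple system $\Delta=\{\alpha_1,\dots,\alpha_n\}$, and let $\Delta_2\subset\Delta$. Let $P$ be the partition of $\{1,2,\dots,n+1\}$ induced by the total preorder associated with the quasitrivial semigroup structure corresponding to $\Phi^+_{\emptyset,\Delta_2}$. Then the number of biclosed sets in the standard parabolic set $\Phi^+_{\emptyset,\Delta_2}$ is given by $$\sum_{P'\unlhd P}(|P'|!)\,2^{b(P')},$$ where $\unlhd$ is the refinement relation on ordered partitions defined in the context, $|P'|$ is the number of subsets in $P'$, and $b(P')$ is the number of subsets in $P'$ whose size is greater than $1$.
   Context: Root system of type $A_n$: $V$ is a real vector space with basis $\alpha_1,\dots,\alpha_n$, $\Phi=\{\pm(\alpha_i+\cdots+\alpha_k):1\le i\le k\le n\}$, $\Phi^+=\{\alpha_i+\cdots+\alpha_k:1\le i\le k\le n\}$, and $\Phi^+_{\emptyset,\Delta_2}=\Phi^+\cup(\mathrm{span}_{\mathbb R}(\Delta_2)\cap\Phi)$. A subset $C\subset\Phi$ is closed if $\alpha,\beta\in C$ and $\alpha+\beta\in\Phi$ imply $\alpha+\beta\in C$. For $D\subset\Phi$, a biclosed set in $D$ is a closed set $B\subset D$ such that $D\setminus B$ is closed. Refinement relation: let $\{A_1,A_2,\dots,A_t\}$ and $\{A_1',A_2',\dots,A_p'\}$ be two ordered partitions of the same set $\{1,2,\dots,N\}$. Write $\{A_1',\dots,A_p'\}\unlhd\{A_1,\dots,A_t\}$ if each $A_i$ is a union of $A_j',A_{j+1}',\dots,A_k'$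 (i.e. the former is a refinement of the latter). The partition $P$: a quasitrivial semigroup structure on $X_{n+1}=\{1,\dots,n+1\}$ is an associative $F:X_{n+1}\times X_{n+1}\to X_{n+1}$ with $F(a,b)\in\{a,b\}$ for all $a,b$; it is equivalent to a total preorder $\precsim_F$ (total, transitive relation, with $x\sim y$ meaning $x\precsim_F y$ and $y\precsim_F x$) such that $F(x,y)$ is the maximum of $x,y$ if $x\nsim y$, and $F$ restricts to one of the two projections on each equivalence class. Biclosed sets $C$ in $\Phi$ correspond bijectively to such structures $F$ as follows: for $j\le k$ and $\alpha_{j,k+1}=\alpha_j+\cdots+\alpha_k$, one has $F(j,k+1)=k+1$ if and only if $\alpha_{j,k+1}\in C$, and $F(k+1,j)=j$ if and only if $-\alpha_{j,k+1}\in C$. The set $\Phi^+_{\emptyset,\Delta_2}$ is biclosed in $\Phi$; let $F$ be its corresponding structure. Its preorder $\precsim_F$ satisfies $1\precsim_F 2\precsim_F\cdots\precsim_F n+1$, with $i\sim i+1$ if and only if $\alpha_i\in\Delta_2$. $P$ is the partition of $\{1,\dots,n+1\}$ into the equivalence classes of $\precsim_F$, which are totally ordered by $\precsim_F$.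
   Formalization: The sum counts each family of blocks P' refining P once, regardless of the order of its blocks; summing over ordered partitions P' would be false (n=1, Δ_2 empty gives 4, but there are only 2 biclosed sets). *)

theory Defs
  imports Complex_Main "HOL-Library.Disjoint_Sets"
begin

section \<open>Root systems of type A\<close>

text \<open>The vectors \<open>\<alpha> 1, \<dots>, \<alpha> n\<close> are the simple roots, a basis of the ambient space;
  values of \<open>\<alpha>\<close> at other indices are irrelevant.\<close>

definition indexed_basis :: "nat \<Rightarrow> (nat \<Rightarrow> 'v::real_vector) \<Rightarrow> bool" where
  "indexed_basis n \<alpha> \<longleftrightarrow>
     inj_on \<alpha> {1..n} \<and> independent (\<alpha> ` {1..n}) \<and> span (\<alpha> ` {1..n}) = UNIV"

definition simple_roots :: "nat \<Rightarrow> (nat \<Rightarrow> 'v::real_vector) \<Rightarrow> 'v set" where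
  "simple_roots n \<alpha> = \<alpha> ` {1..n}"

definition pos_roots :: "nat \<Rightarrow> (nat \<Rightarrow> 'v::real_vector) \<Rightarrow> 'v set" where
  "pos_roots n \<alpha> = {\<Sum>i=j..k. \<alpha> i | j k. 1 \<le> j \<and> j \<le> k \<and> k \<le> n}"

definition roots :: "nat \<Rightarrow> (nat \<Rightarrow> 'v::real_vector) \<Rightarrow> 'v set" where
  "roots n \<alpha> = pos_roots n \<alpha> \<union> uminus ` pos_roots n \<alpha>"

text \<open>The standard parabolic set \<open>\<Phi>\<^sup>+\<^bsub>\<emptyset>,\<Delta>2\<^esub>\<close>.\<close>

definition std_parabolic :: "nat \<Rightarrow> (nat \<Rightarrow> 'v::real_vector) \<Rightarrow> 'v set \<Rightarrow> 'v set" where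
  "std_parabolic n \<alpha> \<Delta>2 = pos_roots n \<alpha> \<union> (span \<Delta>2 \<inter> roots n \<alpha>)"

definition closed_roots :: "'v::real_vector set \<Rightarrow> 'v set \<Rightarrow> bool" where
  "closed_roots \<Phi> C \<longleftrightarrow> C \<subseteq> \<Phi> \<and> (\<forall>x\<in>C. \<forall>y\<in>C. x + y \<in> \<Phi> \<longrightarrow> x + y \<in> C)"

text \<open>Closedness of \<open>B\<close> and of \<open>D - B\<close> is relative to all of \<open>\<Phi>\<close>, not to \<open>D\<close>.\<close>

definition biclosed_in :: "'v::real_vector set \<Rightarrow> 'v set \<Rightarrow> 'v set \<Rightarrow> bool" where
  "biclosed_in \<Phi> D B \<longleftrightarrow> B \<subseteq> D \<and> closed_roots \<Phi> B \<and> closed_roots \<Phi> (D - B)"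


section \<open>Quasitrivial semigroups\<close>

definition quasitrivial_semigroup :: "'a set \<Rightarrow> ('a \<Rightarrow> 'a \<Rightarrow> 'a) \<Rightarrow> bool" where
  "quasitrivial_semigroup X F \<longleftrightarrow>
     (\<forall>a\<in>X. \<forall>b\<in>X. F a b \<in> {a, b}) \<and>
     (\<forall>a\<in>X. \<forall>b\<in>X. \<forall>c\<in>X. F (F a b) c = F a (F b c))"

text \<open>The pair \<open>(x, y) \<in> R\<close> means that \<open>x\<close> is below or equivalent to \<open>y\<close>, so the equivalence
  relation of \<open>R\<close> is \<open>R \<inter> R\<inverse>\<close>. Since \<open>R\<close> is reflexive on \<open>X\<close>, \<^const>\<open>total_on\<close> is
  totality in the strong sense. At most one such \<open>R\<close> exists for a given \<open>F\<close>.\<close>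

definition total_preorder_of :: "'a set \<Rightarrow> ('a \<Rightarrow> 'a \<Rightarrow> 'a) \<Rightarrow> 'a rel \<Rightarrow> bool" where
  "total_preorder_of X F R \<longleftrightarrow>
     preorder_on X R \<and> total_on X R \<and>
     (\<forall>x\<in>X. \<forall>y\<in>X. (x, y) \<in> R \<and> (y, x) \<notin> R \<longrightarrow> F x y = y \<and> F y x = y) \<and>
     (\<forall>E \<in> X // (R \<inter> R\<inverse>).
        (\<forall>x\<in>E. \<forall>y\<in>E. F x y = x) \<or> (\<forall>x\<in>E. \<forall>y\<in>E. F x y = y))"

text \<open>The structure on \<open>{1..n+1}\<close> matching a biclosed set \<open>C\<close> of roots; together with
  quasitriviality this determines \<open>F\<close> on \<open>{1..n+1}\<close>.\<close>

definition corresponds_to :: "nat \<Rightarrow> (nat \<Rightarrow> 'v::real_vector) \<Rightarrow> 'v set \<Rightarrow> (nat \<Rightarrow> nat \<Rightarrow> nat) \<Rightarrow> bool"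
  where
  "corresponds_to n \<alpha> C F \<longleftrightarrow>
     quasitrivial_semigroup {1..n+1} F \<and>
     (\<forall>j k. 1 \<le> j \<and> j \<le> k \<and> k \<le> n \<longrightarrow>
        (F j (k+1) = k+1 \<longleftrightarrow> (\<Sum>i=j..k. \<alpha> i) \<in> C) \<and>
        (F (k+1) j = j \<longleftrightarrow> - (\<Sum>i=j..k. \<alpha> i) \<in> C))"


section \<open>Ordered partitions\<close>

definition ordered_partition :: "'a set \<Rightarrow> 'a set list \<Rightarrow> bool" where
  "ordered_partition X P \<longleftrightarrow> distinct P \<and> partition_on X (set P)"

text \<open>The equivalence classes of a total preorder, listed in increasing order.\<close>

definition preorder_classes :: "'a set \<Rightarrow> 'a rel \<Rightarrow> 'a set list \<Rightarrow> bool" where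
  "preorder_classes X R P \<longleftrightarrow>
     distinct P \<and> set P = X // (R \<inter> R\<inverse>) \<and>
     sorted_wrt (\<lambda>A B. \<forall>x\<in>A. \<forall>y\<in>B. (x, y) \<in> R) P"

text \<open>\<open>refines P' P\<close>: each block of \<open>P\<close> is a union of consecutive blocks of \<open>P'\<close>.\<close>

definition refines :: "'a set list \<Rightarrow> 'a set list \<Rightarrow> bool" where
  "refines P' P \<longleftrightarrow>
     (\<forall>A \<in> set P. \<exists>j k. j \<le> k \<and> k < length P' \<and> A = (\<Union>i\<in>{j..k}. P' ! i))"

text \<open>The refinements \<open>{A'\<^sub>1, \<dots>, A'\<^sub>p}\<close> of \<open>P\<close>, recorded as sets of blocks. Listings of the
  same blocks in different orders are identified: in the counting formula the factor \<open>|P'|!\<close>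
  already accounts for all orders of the blocks of \<open>P'\<close>. (For \<open>n = 1\<close> and \<open>\<Delta>2 = {\<alpha> 1}\<close>, where all
  four subsets of the two roots are biclosed, the sum over listings would be \<open>6\<close>.)\<close>

definition refinements :: "'a set \<Rightarrow> 'a set list \<Rightarrow> 'a set set set" where
  "refinements X P = {set P' | P'. ordered_partition X P' \<and> refines P' P}"

definition num_nonsingleton :: "'a set set \<Rightarrow> nat" where
  "num_nonsingleton Q = card {A \<in> Q. card A > 1}"

end

theory Submission
  imports Defs "HOL-Combinatorics.Multiset_Permutations"
begin

text \<open>Sending \<open>(i, j)\<close> to \<open>e i - e j\<close> identifies the roots with the pairs of distinct indices and closed
  sets with relations that are transitive off the diagonal. The standard parabolic set becomes the
  off-diagonal part of the total preorder \<open>R\<close>, whose classes form \<open>P\<close>. A biclosed \<open>T \<subseteq> R - Id\<close> induces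
  a strict weak order: \<open>i\<close> comes before \<open>j\<close> if every available pair among \<open>(i, j)\<close>, \<open>(j, i)\<close> votes for it,
  that is, \<open>(i, j) \<in> R\<close> implies \<open>(i, j) \<in> T\<close> and \<open>(j, i) \<in> R\<close> implies \<open>(j, i) \<notin> T\<close>. Ties occur only
  inside classes of \<open>R\<close>, so the tie classes form a partition refining \<open>P\<close>; on each of them \<open>T\<close> contains
  either all pairs or none. Conversely \<open>T\<close> is recovered from the refinement, an arbitrary linear order of
  its blocks and an arbitrary choice of the non-singleton blocks on which all pairs are taken.\<close>


section \<open>Lists of blocks\<close>

text \<open>If the heads differed, each would occur in the tail of the other list, and
  \<open>P\<close> would hold between them both ways. This recovers a listing of blocks from its set
  of blocks and their order.\<close>

lemma sorted_wrt_asym_unique: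
  assumes "asymp_on (set xs) P" and "sorted_wrt P xs" and "sorted_wrt P ys" and "set xs = set ys"
  shows "xs = ys"
  using assms
proof (induction xs arbitrary: ys)
  case Nil
  then show ?case by simp
next
  case (Cons a xs)
  then obtain b ys' where ys: "ys = b # ys'" by (cases ys) simp_all
  have xs: "\<forall>x\<in>set xs. P a x" "sorted_wrt P xs" and ys': "\<forall>y\<in>set ys'. P b y" "sorted_wrt P ys'"
    using Cons.prems(2,3) ys by simp_all
  have sets: "insert a (set xs) = insert b (set ys')"
    using Cons.prems(4) ys by simp
  have asym: "\<not> P d c" if "P c d" "c \<in> insert a (set xs)" "d \<in> insert a (set xs)" for c d
    using asymp_onD[OF Cons.prems(1) _ _ that(1)] that(2,3) by simp
  have "a = b"
  proof (rule ccontr)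
    assume "a \<noteq> b"
    have "b \<in> insert a (set xs)" "a \<in> insert b (set ys')" by (simp only: sets, simp) (simp flip: sets)
    with \<open>a \<noteq> b\<close> have "b \<in> set xs" "a \<in> set ys'" by simp_all
    with xs(1) ys'(1) have "P a b" "P b a" by simp_all
    with asym[of a b] \<open>b \<in> set xs\<close> show False by simp
  qed
  moreover have "a \<notin> set xs" using xs(1) asym[of a a] by auto
  moreover have "b \<notin> set ys'" using ys'(1) asym[of a a] \<open>a = b\<close> by auto
  ultimately have "set xs = set ys'" using sets by (metis insert_ident)
  moreover have "asymp_on (set xs) P"
    using Cons.prems(1) by (rule asymp_on_subset) auto
  ultimately have "xs = ys'" using xs(2) ys'(2) by (intro Cons.IH)
  with ys \<open>a = b\<close> show ?case by simp
qed

text \<open>Meaningful for \<open>x\<close> in \<open>X\<close> when \<open>L\<close> is an ordered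
  partition of \<open>X\<close>: disjoint blocks and a distinct list make the position
  unique.\<close>

definition block_index :: "'a set list \<Rightarrow> 'a \<Rightarrow> nat" where
  "block_index L x = (THE a. a < length L \<and> x \<in> L ! a)"

lemma block_index_eqI:
  assumes "ordered_partition X L" and "a < length L" and "x \<in> L ! a"
  shows "block_index L x = a"
  unfolding block_index_def
proof (rule the_equality)
  fix b assume b: "b < length L \<and> x \<in> L ! b"
  have "disjoint (set L)" using assms(1) by (simp add: ordered_partition_def partition_on_def)
  moreover have "L ! a \<in> set L" "L ! b \<in> set L" "L ! a \<inter> L ! b \<noteq> {}"
    using assms b by auto
  ultimately have "L ! b = L ! a" by (metis disjointD)
  with assms b show "b = a"
    by (simp add: ordered_partition_def nth_eq_iff_index_eq)
qed (use assms in simp)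

lemma block_index:
  assumes "ordered_partition X L" and "x \<in> X"
  shows "block_index L x < length L" and "x \<in> L ! block_index L x"
proof -
  from assms have "x \<in> \<Union> (set L)" by (simp add: ordered_partition_def partition_on_def)
  then obtain a where "a < length L" "x \<in> L ! a" by (auto simp: in_set_conv_nth)
  with block_index_eqI[OF assms(1) this]
  show "block_index L x < length L" "x \<in> L ! block_index L x" by simp_all
qed

lemma nth_block_eq:
  assumes "ordered_partition X L" and "a < length L"
  shows "L ! a = {x \<in> X. block_index L x = a}"
proof (intro set_eqI iffI)
  fix x assume x: "x \<in> L ! a"
  then have "x \<in> X" using assms by (auto simp: ordered_partition_def partition_on_def)
  then show "x \<in> {x \<in> X. block_index L x = a}" using block_index_eqI[OF assms x] by simp
next
  fix x assume "x \<in> {x \<in> X. block_index L x = a}"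
  then show "x \<in> L ! a" using block_index(2)[OF assms(1), of x] by simp
qed


section \<open>Biclosed relations below a total preorder\<close>

text \<open>The condition \<open>i \<noteq> k\<close> reflects that opposite roots add up to zero,
  which is not a root.\<close>

definition closed_rel :: "'a rel \<Rightarrow> bool" where
  "closed_rel T \<longleftrightarrow> (\<forall>i j k. (i, j) \<in> T \<longrightarrow> (j, k) \<in> T \<longrightarrow> i \<noteq> k \<longrightarrow> (i, k) \<in> T)"

definition biclosed_rel :: "'a rel \<Rightarrow> 'a rel \<Rightarrow> bool" where
  "biclosed_rel R T \<longleftrightarrow> T \<subseteq> R - Id \<and> closed_rel T \<and> closed_rel (R - Id - T)"

text \<open>For \<open>i\<close> and \<open>j\<close> comparable in only one direction, the single available pair decides between
  \<open>i\<close> before \<open>j\<close> and \<open>j\<close> before \<open>i\<close>; no tie is possible.\<close>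

definition before :: "'a rel \<Rightarrow> 'a rel \<Rightarrow> 'a \<Rightarrow> 'a \<Rightarrow> bool" where
  "before R T i j \<longleftrightarrow> ((i, j) \<in> R \<longrightarrow> (i, j) \<in> T) \<and> ((j, i) \<in> R \<longrightarrow> (j, i) \<notin> T)"

text \<open>\<open>S\<close> collects the blocks on which the pairs are put into the relation.\<close>

definition layered_rel :: "'a rel \<Rightarrow> 'a set list \<Rightarrow> 'a set set \<Rightarrow> 'a rel" where
  "layered_rel R L S = {(i, j) \<in> R. i \<noteq> j \<and>
     (block_index L i < block_index L j \<or>
      block_index L i = block_index L j \<and> L ! block_index L i \<in> S)}"

text \<open>For a total preorder \<open>R\<close> the second condition says that each block lies in
  one class: refinement of the partition into classes, stated without any listing.\<close>

definition fine_partitions :: "'a set \<Rightarrow> 'a rel \<Rightarrow> 'a set set set" where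
  "fine_partitions X R = {Q. partition_on X Q \<and> (\<forall>A\<in>Q. A \<times> A \<subseteq> R)}"

locale finite_total_preorder =
  fixes X :: "'a set" and R :: "'a rel"
  assumes finite: "finite X" and preorder: "preorder_on X R" and total: "total_on X R"
begin

lemma R_sub: "R \<subseteq> X \<times> X" and R_refl: "x \<in> X \<Longrightarrow> (x, x) \<in> R"
  and R_trans: "(x, y) \<in> R \<Longrightarrow> (y, z) \<in> R \<Longrightarrow> (x, z) \<in> R"
  and R_total: "x \<in> X \<Longrightarrow> y \<in> X \<Longrightarrow> (x, y) \<in> R \<or> (y, x) \<in> R"
proof -
  have "R \<subseteq> X \<times> X" and refl: "refl_on X R" and "trans R"
    using preorder by (simp_all add: preorder_on_def)
  show "R \<subseteq> X \<times> X" by fact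
  show "(x, y) \<in> R \<Longrightarrow> (y, z) \<in> R \<Longrightarrow> (x, z) \<in> R"
    using \<open>trans R\<close> by (rule transD)
  show "x \<in> X \<Longrightarrow> (x, x) \<in> R"
    using refl by (rule refl_onD)
  show "x \<in> X \<Longrightarrow> y \<in> X \<Longrightarrow> (x, y) \<in> R \<or> (y, x) \<in> R"
    using refl total by (cases "x = y") (simp_all add: refl_on_def total_on_def)
qed

lemma fine_block:
  assumes "set L \<in> fine_partitions X R" and "distinct L"
    and "x \<in> X" "y \<in> X" "block_index L x = block_index L y"
  shows "(x, y) \<in> R"
proof -
  have op: "ordered_partition X L" using assms by (auto simp: fine_partitions_def ordered_partition_def)
  have "x \<in> L ! block_index L x" "y \<in> L ! block_index L x" "L ! block_index L x \<in> set L"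
    using block_index[OF op assms(3)] block_index[OF op assms(4)] assms(5) by auto
  with assms(1) show ?thesis by (auto simp: fine_partitions_def)
qed

text \<open>Along two composable pairs the block index never falls in the layered relation and never
  rises in its complement. If it stays constant, membership of one and the same block in
  \<open>S\<close> decides all the pairs.\<close>

lemma biclosed_layered_rel: "biclosed_rel R (layered_rel R L S)"
proof -
  have "closed_rel (layered_rel R L S)"
    unfolding closed_rel_def layered_rel_def by (auto intro: R_trans)
  moreover have "closed_rel (R - Id - layered_rel R L S)"
    unfolding closed_rel_def layered_rel_def by (auto intro: R_trans)
  ultimately show ?thesis by (auto simp: biclosed_rel_def layered_rel_def)
qed

text \<open>The order of the blocks can thus be read off from the relation. On a tie, fineness puts
  both pairs into \<open>R\<close>, and both are treated alike by \<open>S\<close>, so one of the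
  two votes fails.\<close>

lemma before_layered_rel:
  assumes "set L \<in> fine_partitions X R" and "distinct L" and "i \<in> X" and "j \<in> X"
  shows "before R (layered_rel R L S) i j \<longleftrightarrow> block_index L i < block_index L j"
proof (cases "block_index L i" "block_index L j" rule: linorder_cases)
  case less
  then show ?thesis unfolding before_def layered_rel_def by auto
next
  case equal
  with fine_block[OF assms] fine_block[OF assms(1,2,4,3)] have "(i, j) \<in> R" "(j, i) \<in> R" by simp_all
  with equal show ?thesis unfolding before_def layered_rel_def by auto
next
  case greater
  \<comment> \<open>Whichever pair lies in \<open>R\<close> votes against: \<open>(i, j)\<close> is
    left out of the relation, \<open>(j, i)\<close> is taken.\<close>
  with R_total[OF assms(3,4)] show ?thesis unfolding before_def layered_rel_def by auto
qed

text \<open>The relation determines \<open>before\<close>, hence the comparisons of block indices,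
  hence the blocks and their order. \<open>S\<close> is then visible on any off-diagonal pair inside
  a block; singletons have none, which is why \<open>S\<close> ranges over larger blocks.\<close>

lemma layered_rel_inj:
  assumes L: "set L \<in> fine_partitions X R" "distinct L" "S \<subseteq> {A \<in> set L. card A > 1}"
    and L': "set L' \<in> fine_partitions X R" "distinct L'" "S' \<subseteq> {A \<in> set L'. card A > 1}"
    and eq: "layered_rel R L S = layered_rel R L' S'"
  shows "L = L'" and "S = S'"
proof -
  have op: "ordered_partition X L" "ordered_partition X L'"
    using L L' by (auto simp: fine_partitions_def ordered_partition_def)
  have less: "block_index L i < block_index L j \<longleftrightarrow> block_index L' i < block_index L' j"
    if "i \<in> X" "j \<in> X" for i j
    using before_layered_rel[OF L(1,2) that] before_layered_rel[OF L'(1,2) that] eq by metis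
  have same: "block_index L i = block_index L j \<longleftrightarrow> block_index L' i = block_index L' j"
    if "i \<in> X" "j \<in> X" for i j
    using less[OF that] less[OF that(2,1)] by (metis nat_neq_iff)
  have sub: "set M \<subseteq> set M'"
    if M: "ordered_partition X M" and M': "ordered_partition X M'"
      and same: "\<And>i j. i \<in> X \<Longrightarrow> j \<in> X \<Longrightarrow>
        block_index M i = block_index M j \<longleftrightarrow> block_index M' i = block_index M' j" for M M'
  proof
    fix A assume "A \<in> set M"
    then obtain a where a: "a < length M" "A = M ! a" by (metis in_set_conv_nth)
    have "A \<noteq> {}" using M \<open>A \<in> set M\<close> by (auto simp: ordered_partition_def partition_on_def)
    then obtain x where x: "x \<in> X" "block_index M x = a"
      using a nth_block_eq[OF M a(1)] by auto
    have "block_index M y = a \<longleftrightarrow> block_index M' y = block_index M' x" if "y \<in> X" for y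
      using same[OF that x(1)] x(2) by simp
    then have "A = M' ! block_index M' x"
      using a(2) nth_block_eq[OF M a(1)] nth_block_eq[OF M' block_index(1)[OF M' x(1)]] by auto
    then show "A \<in> set M'" using block_index(1)[OF M' x(1)] by simp
  qed
  have sets: "set L = set L'"
  proof
    show "set L \<subseteq> set L'" by (rule sub[OF op]) (rule same)
    show "set L' \<subseteq> set L" by (rule sub[OF op(2,1)]) (rule same[symmetric])
  qed
  \<comment> \<open>Both lists are compared by the index of \<open>L\<close>. Asymmetry rests on the
    blocks being nonempty, as \<open>?P\<close> is vacuous on the empty set.\<close>
  let ?P = "\<lambda>A B. \<forall>x\<in>A. \<forall>y\<in>B. block_index L x < block_index L y"
  have sorted: "sorted_wrt ?P M"
    if M: "ordered_partition X M"
      and less: "\<And>i j. i \<in> X \<Longrightarrow> j \<in> X \<Longrightarrow>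
        block_index L i < block_index L j \<longleftrightarrow> block_index M i < block_index M j" for M
    using less by (simp add: sorted_wrt_iff_nth_less nth_block_eq[OF M])
  show "L = L'"
  proof (rule sorted_wrt_asym_unique[where P = ?P])
    show "asymp_on (set L) ?P"
    proof (rule asymp_onI)
      fix A B assume "A \<in> set L" "B \<in> set L" and AB: "?P A B"
      then have "A \<noteq> {}" "B \<noteq> {}"
        using op(1) by (auto simp: ordered_partition_def partition_on_def)
      with AB show "\<not> ?P B A" by (meson all_not_in_conv order.asym)
    qed
    show "sorted_wrt ?P L" by (rule sorted[OF op(1)]) (rule refl)
    show "sorted_wrt ?P L'" by (rule sorted[OF op(2)]) (rule less)
  qed (rule sets)
  have selected: "A \<in> S \<longleftrightarrow> (\<exists>x\<in>A. \<exists>y\<in>A. (x, y) \<in> layered_rel R L S)"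
    if A: "A \<in> set L" "card A > 1" for A S
  proof -
    obtain a where a: "a < length L" "A = L ! a" using A by (metis in_set_conv_nth)
    have "finite A" using A(2) card.infinite by fastforce
    then have "\<not> (\<forall>x\<in>A. \<forall>y\<in>A. x = y)" using A(2) card_le_Suc0_iff_eq[of A] by simp
    then obtain x y where xy: "x \<in> A" "y \<in> A" "x \<noteq> y" by blast
    have X: "z \<in> X \<and> block_index L z = a" if "z \<in> A" for z
      using that a nth_block_eq[OF op(1) a(1)] by auto
    have "(x, y) \<in> R" using fine_block[OF L(1,2)] X xy by simp
    then have "A \<in> S \<Longrightarrow> (x, y) \<in> layered_rel R L S"
      using X xy a(2) unfolding layered_rel_def by simp
    moreover have "A \<in> S" if "u \<in> A" "v \<in> A" "(u, v) \<in> layered_rel R L S" for u v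
      using that X[of u] X[of v] a(2) unfolding layered_rel_def by simp
    ultimately show ?thesis using xy by blast
  qed
  show "S = S'"
  proof (intro set_eqI)
    fix A
    have "A \<in> S \<Longrightarrow> A \<in> set L \<and> card A > 1" "A \<in> S' \<Longrightarrow> A \<in> set L \<and> card A > 1"
      using L(3) L'(3) sets by auto
    with selected[of A S] selected[of A S'] eq \<open>L = L'\<close> show "A \<in> S \<longleftrightarrow> A \<in> S'" by metis
  qed
qed

section \<open>The strict weak order induced by a biclosed relation\<close>

context
  fixes T :: "'a rel"
  assumes T: "biclosed_rel R T"
begin

lemma T_sub: "(i, j) \<in> T \<Longrightarrow> (i, j) \<in> R \<and> i \<noteq> j"
  and T_closed: "(i, j) \<in> T \<Longrightarrow> (j, k) \<in> T \<Longrightarrow> i \<noteq> k \<Longrightarrow> (i, k) \<in> T"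
proof -
  from T have "T \<subseteq> R - Id" and cl: "closed_rel T" by (simp_all add: biclosed_rel_def)
  then show "(i, j) \<in> T \<Longrightarrow> (i, j) \<in> R \<and> i \<noteq> j" by auto
  show "(i, j) \<in> T \<Longrightarrow> (j, k) \<in> T \<Longrightarrow> i \<noteq> k \<Longrightarrow> (i, k) \<in> T"
    using cl unfolding closed_rel_def by (elim allE impE)
qed

text \<open>Passing from \<open>R - Id - T\<close> to \<open>R - T\<close> adds the diagonal, so the
  complement becomes transitive without side conditions on distinctness.\<close>

lemma T_coclosed:
  assumes "(i, j) \<in> R - T" and "(j, k) \<in> R - T"
  shows "(i, k) \<in> R - T"
proof (cases "i = k \<or> i = j \<or> j = k")
  case True
  then show ?thesis using assms T_sub R_trans[of i j k] by auto
next
  case False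
  have "closed_rel (R - Id - T)" using T by (simp add: biclosed_rel_def)
  then have "(i, j) \<in> R - Id - T \<Longrightarrow> (j, k) \<in> R - Id - T \<Longrightarrow> i \<noteq> k \<Longrightarrow> (i, k) \<in> R - Id - T"
    unfolding closed_rel_def by (elim allE impE)
  with False assms show ?thesis by simp
qed

lemma not_before: "\<not> before R T i j \<longleftrightarrow> (i, j) \<in> R - T \<or> (j, i) \<in> T"
  using T_sub by (auto simp: before_def)

text \<open>Negative transitivity, which together with asymmetry makes \<open>before\<close> a
  strict weak order. Two failures of the same kind compose directly; mixed failures are refuted
  through a vote for \<open>i\<close> before \<open>k\<close>.\<close>

lemma not_before_trans:
  assumes X: "i \<in> X" "k \<in> X" and ij: "\<not> before R T i j" and jk: "\<not> before R T j k"
  shows "\<not> before R T i k"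
proof (rule ccontr)
  assume "\<not> \<not> before R T i k"
  then have ik: "(i, k) \<notin> R - T" "(k, i) \<notin> T" unfolding not_before by blast+
  then have "i \<noteq> k" using R_refl[OF X(1)] T_sub by auto
  \<comment> \<open>By totality some pair is available, and it does not vote against. In either
    mixed case, each alternative composes with one of the two given pairs and contradicts the
    other.\<close>
  have *: "(i, k) \<in> T \<or> (k, i) \<in> R - T" using R_total[OF X] ik by auto
  consider "(i, j) \<in> R - T" "(j, k) \<in> R - T" | "(j, i) \<in> T" "(k, j) \<in> T"
    | "(i, j) \<in> R - T" "(k, j) \<in> T" | "(j, i) \<in> T" "(j, k) \<in> R - T"
    using ij jk unfolding not_before by blast
  then show False
  proof cases
    case 1
    with T_coclosed ik show False by blast
  next
    case 2
    with T_closed[of k j i] ik \<open>i \<noteq> k\<close> show False by blast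
  next
    case 3
    with * T_closed[of i k j] T_coclosed[of k i j] ik show False by blast
  next
    case 4
    with * T_closed[of j i k] T_coclosed[of j k i] ik show False by blast
  qed
qed

text \<open>Totality supplies an available pair, so \<open>before\<close> cannot hold vacuously in
  both directions.\<close>

lemma before_asym:
  assumes "i \<in> X" "j \<in> X" "before R T i j"
  shows "\<not> before R T j i"
  using assms(3) R_total[OF assms(1,2)] unfolding before_def by blast

definition rank :: "'a \<Rightarrow> nat" where
  "rank x = card {y \<in> X. before R T y x}"

text \<open>If \<open>x\<close> is before \<open>y\<close>, negative transitivity makes the
  predecessors of \<open>x\<close> predecessors of \<open>y\<close>, and \<open>x\<close> itself is
  a new one. Otherwise the predecessors of \<open>y\<close> are all predecessors of
  \<open>x\<close>.\<close>

lemma rank_less_iff: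
  assumes x: "x \<in> X" and y: "y \<in> X"
  shows "rank x < rank y \<longleftrightarrow> before R T x y"
proof
  assume "before R T x y"
  then have "{z \<in> X. before R T z x} \<subset> {z \<in> X. before R T z y}"
    using x y before_asym[OF x y] before_asym[OF x x] not_before_trans[of _ x y] by blast
  then show "rank x < rank y"
    unfolding rank_def using finite by (intro psubset_card_mono) auto
next
  assume less: "rank x < rank y"
  show "before R T x y"
  proof (rule ccontr)
    assume *: "\<not> before R T x y"
    have "{z \<in> X. before R T z y} \<subseteq> {z \<in> X. before R T z x}"
      using not_before_trans[OF _ y _ *] by blast
    then have "rank y \<le> rank x"
      unfolding rank_def using finite by (intro card_mono) auto
    with less show False by simp
  qed
qed

text \<open>A tie blocks both directions; this forces both pairs into \<open>R\<close> and onto the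
  same side of \<open>T\<close>.\<close>

lemma rank_eqD:
  assumes "x \<in> X" "y \<in> X" "rank x = rank y"
  shows "(x, y) \<in> R" and "(x, y) \<in> T \<longleftrightarrow> (y, x) \<in> T"
proof -
  have "\<not> before R T x y" "\<not> before R T y x"
    using rank_less_iff[of x y] rank_less_iff[of y x] assms by simp_all
  then have *: "(x, y) \<in> R - T \<or> (y, x) \<in> T" "(y, x) \<in> R - T \<or> (x, y) \<in> T"
    by (simp_all only: not_before)
  then show "(x, y) \<in> R" using T_sub by auto
  show "(x, y) \<in> T \<longleftrightarrow> (y, x) \<in> T" using * by blast
qed

text \<open>Were \<open>(x, z)\<close> outside \<open>T\<close>, then so would be
  \<open>(z, x)\<close>. Now \<open>(z, y)\<close> has no place: inside \<open>T\<close> it composes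
  with \<open>(y, x)\<close> to \<open>(z, x)\<close>, outside it composes with
  \<open>(x, z)\<close> to \<open>(x, y)\<close>.\<close>

lemma tie_extend:
  assumes X: "x \<in> X" "y \<in> X" "z \<in> X" and "rank x = rank y" "rank x = rank z"
    and "(x, y) \<in> T" and "x \<noteq> z"
  shows "(x, z) \<in> T"
proof (rule ccontr)
  assume "(x, z) \<notin> T"
  then have xz: "(x, z) \<in> R - T" "(z, x) \<notin> T"
    using rank_eqD[OF X(1,3)] assms(5) by simp_all
  have "(y, x) \<in> T" using rank_eqD[OF X(1,2)] assms(4,6) by simp
  have "y \<noteq> z" using xz assms(6) by auto
  show False
  proof (cases "(z, y) \<in> T")
    case True
    with T_closed[OF True \<open>(y, x) \<in> T\<close>] xz \<open>x \<noteq> z\<close> show False by simp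
  next
    case False
    have "(z, y) \<in> R" using rank_eqD(1)[OF X(3,2)] assms(4,5) by simp
    with False T_coclosed[OF xz(1), of y] assms(6) show False by simp
  qed
qed

text \<open>The endpoints are exchanged one at a time: from \<open>(x, y)\<close> to
  \<open>(x, u)\<close>, reversed to \<open>(u, x)\<close>, then to \<open>(u, v)\<close>.\<close>

lemma tie_homogeneous:
  assumes X: "x \<in> X" "y \<in> X" "u \<in> X" "v \<in> X"
    and eq: "rank x = rank y" "rank x = rank u" "rank x = rank v"
    and T: "(x, y) \<in> T" and "u \<noteq> v"
  shows "(u, v) \<in> T"
proof (cases "u = x")
  case True
  with \<open>u \<noteq> v\<close> show ?thesis using tie_extend[OF X(1,2,4) eq(1,3) T] by blast
next
  case False
  then have "(x, u) \<in> T" using tie_extend[OF X(1,2,3) eq(1,2) T] by blast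
  then have "(u, x) \<in> T" using rank_eqD(2)[OF X(1,3) eq(2)] by blast
  then show ?thesis
    using tie_extend[OF X(3,1,4) eq(2)[symmetric] trans[OF eq(2)[symmetric] eq(3)]] \<open>u \<noteq> v\<close> by blast
qed

lemma biclosed_is_layered:
  obtains L S where "set L \<in> fine_partitions X R" "distinct L" "S \<subseteq> {A \<in> set L. card A > 1}"
    and "layered_rel R L S = T"
proof -
  define vs where "vs = sorted_list_of_set (rank ` X)"
  define level where "level v = {x \<in> X. rank x = v}" for v
  define L where "L = map level vs"
  \<comment> \<open>By homogeneity a level outside \<open>S\<close> with more than one element
    carries no pair of \<open>T\<close>. The cardinality condition discards singletons, where the
    second condition is vacuous.\<close>
  define S where "S = {A \<in> set L. card A > 1 \<and> (\<forall>x\<in>A. \<forall>y\<in>A. x \<noteq> y \<longrightarrow> (x, y) \<in> T)}"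
  have vs: "set vs = rank ` X" "distinct vs" "sorted_wrt (<) vs"
    using finite by (simp_all add: vs_def)
  have "inj_on level (set vs)"
    unfolding vs(1) level_def by (rule inj_onI) blast
  then have "distinct L" using vs(2) by (simp add: L_def distinct_map)
  moreover have "partition_on X (set L)"
    by (rule partition_onI) (auto simp: L_def vs(1) level_def disjnt_def)
  ultimately have op: "ordered_partition X L" by (simp add: ordered_partition_def)
  have "A \<times> A \<subseteq> R" if "A \<in> set L" for A
    using that rank_eqD(1) by (auto simp: L_def level_def)
  with \<open>partition_on X (set L)\<close> have fine: "set L \<in> fine_partitions X R"
    by (simp add: fine_partitions_def)
  have index: "block_index L x < length vs \<and> vs ! block_index L x = rank x" if "x \<in> X" for x
  proof -
    from that have "x \<in> L ! block_index L x" "block_index L x < length vs"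
      using block_index[OF op that] by (simp_all add: L_def)
    then show ?thesis by (simp add: L_def level_def)
  qed
  have block: "L ! block_index L x = level (rank x)" if "x \<in> X" for x
    using index[OF that] by (simp add: L_def)
  have less: "block_index L x < block_index L y \<longleftrightarrow> rank x < rank y" if "x \<in> X" "y \<in> X" for x y
    using index[OF that(1)] index[OF that(2)] sorted_wrt_nth_less[OF vs(3)]
    by (metis linorder_neqE_nat order.asym)
  have eq: "block_index L x = block_index L y \<longleftrightarrow> rank x = rank y" if "x \<in> X" "y \<in> X" for x y
    using less[OF that] less[OF that(2,1)] by (metis nat_neq_iff)
  have "(i, j) \<in> layered_rel R L S \<longleftrightarrow> (i, j) \<in> T" if ij: "(i, j) \<in> R" "i \<noteq> j" for i j
  proof -
    have X: "i \<in> X" "j \<in> X" using ij R_sub by auto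
    consider "rank i < rank j" | "rank j < rank i" | "rank i = rank j" by linarith
    then show ?thesis
    proof cases
      case 1
      with rank_less_iff[OF X] have "(i, j) \<in> T" using ij by (simp add: before_def)
      with 1 ij less[OF X] show ?thesis by (simp add: layered_rel_def)
    next
      case 2
      with rank_less_iff[OF X(2,1)] have "(i, j) \<notin> T" using ij by (simp add: before_def)
      with 2 ij less[OF X] eq[OF X] show ?thesis by (simp add: layered_rel_def)
    next
      case 3
      let ?A = "level (rank i)"
      have A: "i \<in> ?A" "j \<in> ?A" "finite ?A" using X 3 finite by (simp_all add: level_def)
      then have "card ?A > 1" using ij(2) card_le_Suc0_iff_eq[of ?A] by (metis One_nat_def not_le)
      moreover have "?A \<in> set L" using X by (simp add: L_def vs(1))
      moreover have "(\<forall>x\<in>?A. \<forall>y\<in>?A. x \<noteq> y \<longrightarrow> (x, y) \<in> T) \<longleftrightarrow> (i, j) \<in> T"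
        using A ij(2) tie_homogeneous[OF X _ _ 3] by (auto simp: level_def)
      ultimately have "?A \<in> S \<longleftrightarrow> (i, j) \<in> T" by (simp add: S_def)
      with 3 ij less[OF X] eq[OF X] block[OF X(1)] show ?thesis by (simp add: layered_rel_def)
    qed
  qed
  then have "layered_rel R L S = T"
    using T_sub unfolding layered_rel_def by auto
  moreover have "S \<subseteq> {A \<in> set L. card A > 1}" by (auto simp: S_def)
  ultimately show ?thesis using that fine \<open>distinct L\<close> by blast
qed

end

theorem card_biclosed_rel:
  "card {T. biclosed_rel R T} =
    (\<Sum>Q\<in>fine_partitions X R. fact (card Q) * 2 ^ num_nonsingleton Q)"
proof -
  \<comment> \<open>\<open>Q\<close> is just \<open>set L\<close>; keeping it as a component splits
    the count into one summand per partition.\<close>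
  let ?C = "SIGMA Q : fine_partitions X R. permutations_of_set Q \<times> Pow {A \<in> Q. card A > 1}"
  let ?f = "\<lambda>(Q, L, S). layered_rel R L S"
  have fin: "finite (fine_partitions X R)"
    using finitely_many_partition_on[OF finite]
    by (rule rev_finite_subset) (auto simp: fine_partitions_def)
  have finQ: "finite Q" if "Q \<in> fine_partitions X R" for Q
    using that finite_elements[OF finite] by (simp add: fine_partitions_def)
  have "inj_on ?f ?C"
  proof (rule inj_onI)
    fix c c' assume c: "c \<in> ?C" "c' \<in> ?C" and eq: "?f c = ?f c'"
    obtain Q L S Q' L' S' where cc: "c = (Q, L, S)" "c' = (Q', L', S')"
      by (metis prod_cases3)
    have Q: "Q = set L" "Q' = set L'" and "distinct L" "distinct L'"
      using c by (auto simp: cc permutations_of_set_def)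
    moreover from this have "L = L'" "S = S'"
      using layered_rel_inj[of L S L' S'] c eq by (auto simp: cc)
    ultimately show "c = c'" by (simp add: cc)
  qed
  moreover have "?f ` ?C = {T. biclosed_rel R T}"
  proof
    show "?f ` ?C \<subseteq> {T. biclosed_rel R T}" 
      by (rule image_subsetI) (simp add: split_beta biclosed_layered_rel)
    show "{T. biclosed_rel R T} \<subseteq> ?f ` ?C"
    proof
      fix T assume "T \<in> {T. biclosed_rel R T}"
      then obtain L S where "set L \<in> fine_partitions X R" "distinct L"
        "S \<subseteq> {A \<in> set L. card A > 1}" "layered_rel R L S = T"
        using biclosed_is_layered by blast
      then have "(set L, L, S) \<in> ?C" "T = ?f (set L, L, S)"
        by (simp_all add: permutations_of_setI)
      then show "T \<in> ?f ` ?C" by (rule rev_image_eqI)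
    qed
  qed
  ultimately have "bij_betw ?f ?C {T. biclosed_rel R T}" by (rule bij_betw_imageI)
  then have "card {T. biclosed_rel R T} = card ?C" by (rule bij_betw_same_card[symmetric])
  also have "\<dots> = (\<Sum>Q\<in>fine_partitions X R. card (permutations_of_set Q \<times> Pow {A \<in> Q. card A > 1}))"
    using fin finQ by (intro card_SigmaI) auto
  also have "\<dots> = (\<Sum>Q\<in>fine_partitions X R. fact (card Q) * 2 ^ num_nonsingleton Q)"
    using finQ by (intro sum.cong) (simp_all add: card_cartesian_product card_Pow num_nonsingleton_def)
  finally show ?thesis .
qed

end


section \<open>Refinements of the partition into classes\<close>

context finite_total_preorder
begin

lemma equiv_R: "equiv X (R \<inter> R\<inverse>)"
proof (rule equivI)
  show "R \<inter> R\<inverse> \<subseteq> X \<times> X" using R_sub by auto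
  show "refl_on X (R \<inter> R\<inverse>)" by (simp add: refl_on_def R_refl)
  show "sym (R \<inter> R\<inverse>)" by (rule sym_Int_converse)
  show "trans (R \<inter> R\<inverse>)"
    by (rule transI) (simp, blast intro: R_trans)
qed

text \<open>The class of a point \<open>x\<close> of a block \<open>B\<close> is a union of blocks,
  one of which contains \<open>x\<close>. By disjointness that one is \<open>B\<close>, so
  \<open>B\<close> stays inside the class.\<close>

lemma refinements_subset_fine:
  assumes P: "set P = X // (R \<inter> R\<inverse>)"
  shows "refinements X P \<subseteq> fine_partitions X R"
proof
  fix Q assume "Q \<in> refinements X P"
  then obtain P' where Q: "Q = set P'" and op: "ordered_partition X P'" and ref: "refines P' P"
    by (auto simp: refinements_def)
  have part: "partition_on X (set P')" using op by (simp add: ordered_partition_def)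
  have "B \<times> B \<subseteq> R" if B: "B \<in> set P'" for B
  proof -
    obtain x where x: "x \<in> B" using B partition_onD3[OF part] by (metis all_not_in_conv)
    then have "x \<in> X" using B partition_onD1[OF part] by blast
    let ?A = "(R \<inter> R\<inverse>) `` {x}"
    have "?A \<in> set P" unfolding P using \<open>x \<in> X\<close> by (rule quotientI)
    with ref obtain j k where jk: "k < length P'" "?A = (\<Union>i\<in>{j..k}. P' ! i)"
      by (auto simp: refines_def)
    have "x \<in> ?A" using R_refl[OF \<open>x \<in> X\<close>] by simp
    then obtain i where i: "i \<in> {j..k}" "x \<in> P' ! i" using jk(2) by auto
    then have "P' ! i \<in> set P'" using jk(1) by simp
    then have "P' ! i = B"
      using partition_onD2[OF part] B x i(2) by (metis IntI disjointD empty_iff)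
    then have "B \<subseteq> ?A" using jk(2) i(1) by blast
    then show ?thesis using R_trans by blast
  qed
  with part Q show "Q \<in> fine_partitions X R" by (simp add: fine_partitions_def)
qed

text \<open>Listing the blocks class by class, in the order of \<open>P\<close> and arbitrarily
  within a class, makes the blocks of each class consecutive.\<close>

lemma fine_subset_refinements:
  assumes P: "distinct P" "set P = X // (R \<inter> R\<inverse>)"
  shows "fine_partitions X R \<subseteq> refinements X P"
proof
  fix Q assume "Q \<in> fine_partitions X R"
  then have part: "partition_on X Q" and fine: "\<And>B. B \<in> Q \<Longrightarrow> B \<times> B \<subseteq> R"
    by (auto simp: fine_partitions_def)
  have "finite Q" using finite part by (rule finite_elements)
  define blocks where "blocks A = (SOME bs. distinct bs \<and> set bs = {B \<in> Q. B \<subseteq> A})" for A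
  have blocks: "distinct (blocks A)" "set (blocks A) = {B \<in> Q. B \<subseteq> A}" for A
  proof -
    have "\<exists>bs. distinct bs \<and> set bs = {B \<in> Q. B \<subseteq> A}"
      using finite_distinct_list[of "{B \<in> Q. B \<subseteq> A}"] \<open>finite Q\<close> by auto
    then have "distinct (blocks A) \<and> set (blocks A) = {B \<in> Q. B \<subseteq> A}"
      unfolding blocks_def by (rule someI_ex)
    then show "distinct (blocks A)" "set (blocks A) = {B \<in> Q. B \<subseteq> A}" by simp_all
  qed
  have Ppart: "partition_on X (set P)"
    unfolding P(2) by (rule partition_on_quotient[OF equiv_R])
  have inside: "\<exists>A\<in>set P. x \<in> A \<and> B \<subseteq> A" if B: "B \<in> Q" "x \<in> B" for x B
  proof
    have "x \<in> X" using B partition_onD1[OF part] by blast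
    then show "(R \<inter> R\<inverse>) `` {x} \<in> set P" unfolding P(2) by (rule quotientI)
    show "x \<in> (R \<inter> R\<inverse>) `` {x} \<and> B \<subseteq> (R \<inter> R\<inverse>) `` {x}"
      using fine[OF B(1)] B(2) by auto
  qed
  have cover: "\<Union> (set (blocks A)) = A" if A: "A \<in> set P" for A
  proof
    show "A \<subseteq> \<Union> (set (blocks A))"
    proof
      fix x assume x: "x \<in> A"
      then have "x \<in> X" using A partition_onD1[OF Ppart] by blast
      then obtain B where B: "B \<in> Q" "x \<in> B" using partition_onD1[OF part] by blast
      then obtain A' where "A' \<in> set P" "x \<in> A'" "B \<subseteq> A'" using inside by blast
      moreover from this have "A' = A"
        using partition_onD2[OF Ppart] A x by (metis IntI disjointD empty_iff)
      ultimately show "x \<in> \<Union> (set (blocks A))" using B unfolding blocks(2) by blast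
    qed
  qed (auto simp: blocks(2))
  define P' where "P' = concat (map blocks P)"
  have "set P' = Q"
  proof
    show "set P' \<subseteq> Q" by (auto simp: P'_def blocks(2))
    show "Q \<subseteq> set P'"
    proof
      fix B assume B: "B \<in> Q"
      then obtain x where "x \<in> B" using partition_onD3[OF part] by (metis all_not_in_conv)
      with inside[OF B] B show "B \<in> set P'" by (auto simp: P'_def blocks(2))
    qed
  qed
  have disj: "set (blocks A) \<inter> set (blocks A') = {}"
    if "A \<in> set P" "A' \<in> set P" "A \<noteq> A'" for A A'
  proof -
    have "A \<inter> A' = {}" using partition_onD2[OF Ppart] that by (rule disjointD)
    then have "B = {}" if "B \<subseteq> A" "B \<subseteq> A'" for B using that by blast
    then show ?thesis using partition_onD3[OF part] unfolding blocks(2) by blast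
  qed
  have nonempty: "blocks A \<noteq> []" if "A \<in> set P" for A
    using cover[OF that] that partition_onD3[OF Ppart] by auto
  \<comment> \<open>By \<open>cover\<close>, a class is recovered as the union of its listed
    blocks.\<close>
  have "inj_on blocks (set P)"
    using cover by (metis inj_onI)
  then have "distinct (map blocks P)" using P(1) by (simp add: distinct_map)
  then have "distinct P'"
    unfolding P'_def
  proof (rule distinct_concat)
    fix ys assume "ys \<in> set (map blocks P)"
    then show "distinct ys" using blocks(1) by auto
  next
    fix ys zs assume "ys \<in> set (map blocks P)" "zs \<in> set (map blocks P)" and "ys \<noteq> zs"
    then obtain A A' where "A \<in> set P" "A' \<in> set P" "ys = blocks A" "zs = blocks A'" by auto
    with disj[of A A'] \<open>ys \<noteq> zs\<close> show "set ys \<inter> set zs = {}" by auto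
  qed
  moreover have "refines P' P"
    unfolding refines_def
  proof
    fix A assume A: "A \<in> set P"
    then obtain P1 P2 where P12: "P = P1 @ A # P2" by (meson split_list)
    \<comment> \<open>The blocks of \<open>A\<close> occupy the \<open>?m\<close> positions from
      \<open>?j\<close> on. The last one, \<open>?j + ?m - 1\<close>, makes sense because
      \<open>?m\<close> is positive.\<close>
    let ?j = "length (concat (map blocks P1))"
    let ?m = "length (blocks A)"
    have m: "?m > 0" using nonempty[OF A] by simp
    have P': "P' = concat (map blocks P1) @ blocks A @ concat (map blocks P2)"
      by (simp add: P'_def P12)
    have "{j..j + m - 1} = {j..<j + m}" if "m > 0" for j m :: nat using that by auto
    from this[OF m] have "{?j..?j + ?m - 1} = {?j..<?j + ?m}" .
    also have "\<dots> = (+) ?j ` {..<?m}" by (simp add: lessThan_atLeast0 add.commute)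
    finally have "{?j..?j + ?m - 1} = (+) ?j ` {..<?m}" .
    then have "(\<Union>i\<in>{?j..?j + ?m - 1}. P' ! i) = (\<Union>i<?m. P' ! (?j + i))" by simp
    also have "\<dots> = (\<Union>i<?m. blocks A ! i)"
      by (rule SUP_cong) (simp_all add: P' nth_append)
    also have "\<dots> = \<Union> (set (blocks A))" by (auto simp: set_conv_nth)
    also have "\<dots> = A" by (rule cover[OF A])
    finally have "(\<Union>i\<in>{?j..?j + ?m - 1}. P' ! i) = A" .
    moreover have "?j + ?m \<le> length P'" unfolding P' by simp
    then have "?j \<le> ?j + ?m - 1" "?j + ?m - 1 < length P'" using m by linarith+
    ultimately show "\<exists>j k. j \<le> k \<and> k < length P' \<and> A = (\<Union>i\<in>{j..k}. P' ! i)" by metis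
  qed
  ultimately show "Q \<in> refinements X P"
    using part \<open>set P' = Q\<close> by (auto simp: refinements_def ordered_partition_def)
qed

end


section \<open>Roots as pairs of indices\<close>

text \<open>In the usual coordinates \<open>\<alpha> k\<close> is \<open>e k - e (k + 1)\<close>, and this is the root \<open>e i - e j\<close>.\<close>

definition root_of :: "(nat \<Rightarrow> 'v::real_vector) \<Rightarrow> nat \<times> nat \<Rightarrow> 'v" where
  "root_of \<alpha> = (\<lambda>(i, j). (\<Sum>k=1..<j. \<alpha> k) - (\<Sum>k=1..<i. \<alpha> k))"

lemma sum_eq_root:
  assumes "1 \<le> j" and "j \<le> k"
  shows "(\<Sum>i=j..k. \<alpha> i) = root_of \<alpha> (j, k + 1)"
proof -
  have "{1..<k + 1} = {1..<j} \<union> {j..k}" "{1..<j} \<inter> {j..k} = {}" using assms by auto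
  then show ?thesis by (simp add: root_of_def sum.union_disjoint)
qed

lemma uminus_root: "- root_of \<alpha> (i, j) = root_of \<alpha> (j, i)"
  by (simp add: root_of_def)

lemma root_add: "root_of \<alpha> (i, j) + root_of \<alpha> (j, k) = root_of \<alpha> (i, k)"
  by (simp add: root_of_def)

lemma pos_roots_eq: "pos_roots n \<alpha> = root_of \<alpha> ` {(i, j). i \<in> {1..n+1} \<and> j \<in> {1..n+1} \<and> i < j}"
proof (intro set_eqI iffI)
  fix v assume "v \<in> pos_roots n \<alpha>"
  then obtain j k where "1 \<le> j" "j \<le> k" "k \<le> n" "v = (\<Sum>i=j..k. \<alpha> i)"
    by (auto simp: pos_roots_def)
  then show "v \<in> root_of \<alpha> ` {(i, j). i \<in> {1..n+1} \<and> j \<in> {1..n+1} \<and> i < j}"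
    using sum_eq_root[of j k \<alpha>] by (intro image_eqI[of _ _ "(j, k + 1)"]) auto
next
  fix v assume "v \<in> root_of \<alpha> ` {(i, j). i \<in> {1..n+1} \<and> j \<in> {1..n+1} \<and> i < j}"
  then obtain i j where ij: "1 \<le> i" "i < j" "j \<le> n + 1" "v = root_of \<alpha> (i, j)" by auto
  then have "v = (\<Sum>k=i..j-1. \<alpha> k)" using sum_eq_root[of i "j - 1" \<alpha>] by simp
  moreover have "i \<le> j - 1" "j - 1 \<le> n" using ij by auto
  ultimately show "v \<in> pos_roots n \<alpha>" using ij(1) unfolding pos_roots_def by blast
qed

lemma roots_eq: "roots n \<alpha> = root_of \<alpha> ` ({1..n+1} \<times> {1..n+1} - Id)"
proof -
  let ?U = "{(i, j). i \<in> {1..n+1} \<and> j \<in> {1..n+1} \<and> i < j}"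
  have "uminus ` root_of \<alpha> ` ?U = root_of \<alpha> ` prod.swap ` ?U"
    unfolding image_image by (rule image_cong) (auto simp: uminus_root)
  then have "roots n \<alpha> = root_of \<alpha> ` (?U \<union> prod.swap ` ?U)"
    by (simp add: roots_def pos_roots_eq image_Un)
  also have "?U \<union> prod.swap ` ?U = {1..n+1} \<times> {1..n+1} - Id"
    by (auto simp: image_iff)
  finally show ?thesis .
qed

text \<open>The functional \<open>g\<close> reads off the coefficient of \<open>e m\<close>. It is
  prescribed on the simple roots, where \<open>e k - e (k + 1)\<close> has coefficient
  \<open>?f k\<close>, and extended linearly by independence.\<close>

lemma root_coordinate:
  assumes "indexed_basis n \<alpha>"
  obtains g :: "'v::real_vector \<Rightarrow> real" where "linear g"
    and "\<And>i j. i \<in> {1..n+1} \<Longrightarrow> j \<in> {1..n+1} \<Longrightarrow>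
      g (root_of \<alpha> (i, j)) = of_bool (m = i) - of_bool (m = j)"
proof -
  let ?f = "\<lambda>k. of_bool (m = k) - of_bool (m = k + 1) :: real"
  have inj: "inj_on \<alpha> {1..n}" and ind: "independent (\<alpha> ` {1..n})"
    using assms by (simp_all add: indexed_basis_def)
  obtain g where g: "linear g" "\<forall>x\<in>\<alpha> ` {1..n}. g x = ?f (the_inv_into {1..n} \<alpha> x)"
    using linear_independent_extend[OF ind, where f = "\<lambda>x. ?f (the_inv_into {1..n} \<alpha> x)"] by auto
  have *: "g (\<alpha> k) = ?f k" if "k \<in> {1..n}" for k
    using g(2) that the_inv_into_f_f[OF inj that] by simp
  \<comment> \<open>The partial sum telescopes to \<open>e 1 - e i\<close>.\<close>
  have partial: "g (\<Sum>k=1..<i. \<alpha> k) = of_bool (m = 1) - of_bool (m = i)" if "1 \<le> i" "i \<le> n + 1" for i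
    using that
  proof (induction i rule: dec_induct)
    case base
    then show ?case using linear_0[OF g(1)] by simp
  next
    case (step i)
    then show ?case using *[of i] by (simp add: linear_add[OF g(1)])
  qed
  have "g (root_of \<alpha> (i, j)) = of_bool (m = i) - of_bool (m = j)"
    if "i \<in> {1..n+1}" "j \<in> {1..n+1}" for i j
    using partial[of i] partial[of j] that by (simp add: root_of_def linear_diff[OF g(1)])
  with g(1) show thesis by (rule that)
qed

lemma inj_on_root:
  assumes "indexed_basis n \<alpha>"
  shows "inj_on (root_of \<alpha>) ({1..n+1} \<times> {1..n+1} - Id)"
proof (rule inj_onI)
  fix x y assume xy: "x \<in> {1..n+1} \<times> {1..n+1} - Id" "y \<in> {1..n+1} \<times> {1..n+1} - Id"
    and eq: "root_of \<alpha> x = root_of \<alpha> y"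
  obtain i j p q where "x = (i, j)" "y = (p, q)" by (metis prod.exhaust)
  have "of_bool (m = i) - of_bool (m = j) = (of_bool (m = p) - of_bool (m = q) :: real)" for m
  proof (rule root_coordinate[OF assms, of m])
    fix g :: "'a \<Rightarrow> real"
    assume "\<And>i j. i \<in> {1..n+1} \<Longrightarrow> j \<in> {1..n+1} \<Longrightarrow>
      g (root_of \<alpha> (i, j)) = of_bool (m = i) - of_bool (m = j)"
    from this[of i j] this[of p q] xy eq show ?thesis by (simp add: \<open>x = (i, j)\<close> \<open>y = (p, q)\<close>)
  qed
  from this[of i] this[of j] xy show "x = y"
    by (auto simp: \<open>x = (i, j)\<close> \<open>y = (p, q)\<close> of_bool_def split: if_splits)
qed

text \<open>In \<open>e i - e j + e k - e l\<close> only one positive and one negative term may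
  survive, so \<open>j = k\<close> or \<open>i = l\<close> must cancel. Evaluating the coordinates
  at all six indices settles this.\<close>

lemma root_add_cases:
  assumes "indexed_basis n \<alpha>"
    and "{i, j, k, l, p, q} \<subseteq> {1..n+1}" and "i \<noteq> j" "k \<noteq> l" "p \<noteq> q"
    and eq: "root_of \<alpha> (i, j) + root_of \<alpha> (k, l) = root_of \<alpha> (p, q)"
  shows "j = k \<and> p = i \<and> q = l \<or> i = l \<and> p = k \<and> q = j"
proof -
  have e: "of_bool (m = i) - of_bool (m = j) + (of_bool (m = k) - of_bool (m = l)) =
      (of_bool (m = p) - of_bool (m = q) :: real)" for m
  proof (rule root_coordinate[OF assms(1), of m])
    fix g :: "'a \<Rightarrow> real"
    assume "linear g" and g: "\<And>i j. i \<in> {1..n+1} \<Longrightarrow> j \<in> {1..n+1} \<Longrightarrow>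
      g (root_of \<alpha> (i, j)) = of_bool (m = i) - of_bool (m = j)"
    have "g (root_of \<alpha> (i, j)) + g (root_of \<alpha> (k, l)) = g (root_of \<alpha> (p, q))"
      using arg_cong[OF eq, of g] by (simp add: linear_add[OF \<open>linear g\<close>])
    with g[of i j] g[of k l] g[of p q] assms(2) show ?thesis by simp
  qed
  show ?thesis
    using e[of i] e[of j] e[of k] e[of l] e[of p] e[of q] assms(3-5)
    by (auto simp: of_bool_def split: if_splits)
qed

text \<open>Composable pairs add up to roots by \<open>root_add\<close>, and injectivity pulls the
  result back to \<open>T\<close>. Conversely, by \<open>root_add_cases\<close>, two roots with a
  root as sum come from pairs composable in one of the two orders.\<close>

lemma closed_roots_image_iff:
  assumes \<alpha>: "indexed_basis n \<alpha>" and T: "T \<subseteq> {1..n+1} \<times> {1..n+1} - Id"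
  shows "closed_roots (roots n \<alpha>) (root_of \<alpha> ` T) \<longleftrightarrow> closed_rel T"
proof
  assume closed: "closed_roots (roots n \<alpha>) (root_of \<alpha> ` T)"
  show "closed_rel T"
    unfolding closed_rel_def
  proof (intro allI impI)
    fix i j k assume ij: "(i, j) \<in> T" and jk: "(j, k) \<in> T" and "i \<noteq> k"
    then have ik: "(i, k) \<in> {1..n+1} \<times> {1..n+1} - Id" using T by auto
    then have "root_of \<alpha> (i, j) + root_of \<alpha> (j, k) \<in> roots n \<alpha>"
      unfolding root_add roots_eq by (rule imageI)
    with closed ij jk have "root_of \<alpha> (i, k) \<in> root_of \<alpha> ` T"
      unfolding closed_roots_def using root_add by (metis imageI)
    then show "(i, k) \<in> T"
      using inj_on_image_mem_iff[OF inj_on_root[OF \<alpha>] ik T] by simp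
  qed
next
  assume closed: "closed_rel T"
  show "closed_roots (roots n \<alpha>) (root_of \<alpha> ` T)"
    unfolding closed_roots_def
  proof (intro conjI ballI impI)
    show "root_of \<alpha> ` T \<subseteq> roots n \<alpha>" unfolding roots_eq using T by (rule image_mono)
  next
    fix x y assume "x \<in> root_of \<alpha> ` T" "y \<in> root_of \<alpha> ` T" and xy: "x + y \<in> roots n \<alpha>"
    then obtain i j k l where ij: "(i, j) \<in> T" "x = root_of \<alpha> (i, j)" and kl: "(k, l) \<in> T" "y = root_of \<alpha> (k, l)"
      by (metis imageE prod.exhaust)
    obtain r where "r \<in> {1..n+1} \<times> {1..n+1} - Id" "x + y = root_of \<alpha> r"
      using xy unfolding roots_eq by (elim imageE)
    then obtain p q where pq: "(p, q) \<in> {1..n+1} \<times> {1..n+1} - Id" "x + y = root_of \<alpha> (p, q)"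
      by (cases r) simp
    have "{i, j, k, l, p, q} \<subseteq> {1..n+1}" "i \<noteq> j" "k \<noteq> l" "p \<noteq> q"
      using T ij(1) kl(1) pq(1) by auto
    from root_add_cases[OF \<alpha> this] ij kl pq
    consider "j = k" "p = i" "q = l" | "i = l" "p = k" "q = j" by auto
    then have "(p, q) \<in> T"
    proof cases
      case 1
      with closed ij(1) kl(1) \<open>p \<noteq> q\<close> show ?thesis unfolding closed_rel_def by auto
    next
      case 2
      with closed ij(1) kl(1) \<open>p \<noteq> q\<close> show ?thesis unfolding closed_rel_def by auto
    qed
    then show "x + y \<in> root_of \<alpha> ` T" unfolding pq(2) by (rule imageI)
  qed
qed

lemma biclosed_in_image_iff:
  assumes \<alpha>: "indexed_basis n \<alpha>" and R: "R \<subseteq> {1..n+1} \<times> {1..n+1}" and T: "T \<subseteq> R - Id"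
  shows "biclosed_in (roots n \<alpha>) (root_of \<alpha> ` (R - Id)) (root_of \<alpha> ` T) \<longleftrightarrow> biclosed_rel R T"
proof -
  have sub: "R - Id \<subseteq> {1..n+1} \<times> {1..n+1} - Id" using R by blast
  have "root_of \<alpha> ` (R - Id) - root_of \<alpha> ` T = root_of \<alpha> ` (R - Id - T)"
    by (rule inj_on_image_set_diff[OF inj_on_root[OF \<alpha>], symmetric]) (use sub T in auto)
  moreover have "T \<subseteq> {1..n+1} \<times> {1..n+1} - Id" "R - Id - T \<subseteq> {1..n+1} \<times> {1..n+1} - Id"
    using sub T by auto
  ultimately show ?thesis
    using T closed_roots_image_iff[OF \<alpha>] unfolding biclosed_in_def biclosed_rel_def
    by (simp add: image_mono)
qed

lemma card_biclosed_in:
  assumes \<alpha>: "indexed_basis n \<alpha>" and R: "R \<subseteq> {1..n+1} \<times> {1..n+1}"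
  shows "card {B. biclosed_in (roots n \<alpha>) (root_of \<alpha> ` (R - Id)) B} = card {T. biclosed_rel R T}"
proof -
  have inj: "inj_on (root_of \<alpha>) (R - Id)"
    using inj_on_root[OF \<alpha>] by (rule inj_on_subset) (use R in blast)
  have "{B. biclosed_in (roots n \<alpha>) (root_of \<alpha> ` (R - Id)) B} = (`) (root_of \<alpha>) ` {T. biclosed_rel R T}"
  proof (intro set_eqI iffI)
    fix B assume "B \<in> {B. biclosed_in (roots n \<alpha>) (root_of \<alpha> ` (R - Id)) B}"
    moreover from this obtain T where "T \<subseteq> R - Id" "B = root_of \<alpha> ` T"
      by (auto simp: biclosed_in_def subset_image_iff)
    ultimately show "B \<in> (`) (root_of \<alpha>) ` {T. biclosed_rel R T}"
      using biclosed_in_image_iff[OF \<alpha> R] by auto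
  next
    fix B assume "B \<in> (`) (root_of \<alpha>) ` {T. biclosed_rel R T}"
    then obtain T where "biclosed_rel R T" "B = root_of \<alpha> ` T" by auto
    then show "B \<in> {B. biclosed_in (roots n \<alpha>) (root_of \<alpha> ` (R - Id)) B}"
      using biclosed_in_image_iff[OF \<alpha> R, of T] by (simp add: biclosed_rel_def)
  qed
  moreover have "inj_on ((`) (root_of \<alpha>)) {T. biclosed_rel R T}"
    using inj_on_image_Pow[OF inj] by (rule inj_on_subset) (auto simp: biclosed_rel_def)
  ultimately show ?thesis by (simp add: card_image)
qed

text \<open>As \<open>D\<close> contains all positive roots, \<open>F i j = j\<close> for
  \<open>i < j\<close>, which forces \<open>(i, j)\<close> into \<open>R\<close>. Whether
  \<open>(j, i)\<close> is in \<open>R\<close> is then equivalent to \<open>F j i = i\<close>, that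
  is, to the negative root lying in \<open>D\<close>.\<close>

lemma parabolic_eq_image:
  assumes \<alpha>: "indexed_basis n \<alpha>"
    and D: "pos_roots n \<alpha> \<subseteq> D" "D \<subseteq> roots n \<alpha>"
    and F: "corresponds_to n \<alpha> D F" and R: "total_preorder_of {1..n+1} F R"
  shows "D = root_of \<alpha> ` (R - Id)"
proof -
  let ?X = "{1..n+1}"
  have pre: "preorder_on ?X R" "total_on ?X R"
    and strict: "\<And>x y. x \<in> ?X \<Longrightarrow> y \<in> ?X \<Longrightarrow> (x, y) \<in> R \<Longrightarrow> (y, x) \<notin> R \<Longrightarrow> F x y = y \<and> F y x = y"
    and proj: "\<And>E. E \<in> ?X // (R \<inter> R\<inverse>) \<Longrightarrow>
        (\<forall>x\<in>E. \<forall>y\<in>E. F x y = x) \<or> (\<forall>x\<in>E. \<forall>y\<in>E. F x y = y)"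
    using R unfolding total_preorder_of_def by blast+
  interpret finite_total_preorder ?X R by unfold_locales (use pre in simp_all)
  have corr: "(F i j = j \<longleftrightarrow> root_of \<alpha> (i, j) \<in> D) \<and> (F j i = i \<longleftrightarrow> root_of \<alpha> (j, i) \<in> D)"
    if "i \<in> ?X" "j \<in> ?X" "i < j" for i j
  proof -
    have "1 \<le> i \<and> i \<le> j - 1 \<and> j - 1 \<le> n" "j - 1 + 1 = j" using that by auto
    with F sum_eq_root[of i "j - 1" \<alpha>] show ?thesis
      unfolding corresponds_to_def by (metis uminus_root)
  qed
  have up: "(i, j) \<in> R \<and> root_of \<alpha> (i, j) \<in> D \<and> ((j, i) \<in> R \<longleftrightarrow> root_of \<alpha> (j, i) \<in> D)"
    if X: "i \<in> ?X" "j \<in> ?X" and "i < j" for i j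
  proof -
    have "root_of \<alpha> (i, j) \<in> D" using D(1) that unfolding pos_roots_eq by blast
    then have Fij: "F i j = j" using corr[OF that] by simp
    have "(i, j) \<in> R"
    proof (rule ccontr)
      assume "(i, j) \<notin> R"
      with strict[OF X(2,1)] R_total[OF X] have "F i j = i" by blast
      with Fij \<open>i < j\<close> show False by simp
    qed
    moreover have "(j, i) \<in> R \<longleftrightarrow> F j i = i"
    proof
      assume ji: "(j, i) \<in> R"
      let ?E = "(R \<inter> R\<inverse>) `` {i}"
      have "?E \<in> ?X // (R \<inter> R\<inverse>)" using X(1) by (rule quotientI)
      moreover have "i \<in> ?E" "j \<in> ?E" using ji \<open>(i, j) \<in> R\<close> R_refl[OF X(1)] by auto
      \<comment> \<open>\<open>F i j = j\<close> with \<open>i \<noteq> j\<close> excludes the first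
        projection on the class, so \<open>F\<close> is the second one there.\<close>
      ultimately show "F j i = i" using proj[of ?E] Fij \<open>i < j\<close> by (metis less_irrefl)
    next
      assume "F j i = i"
      with strict[OF X] \<open>(i, j) \<in> R\<close> \<open>i < j\<close> show "(j, i) \<in> R" by (metis less_irrefl)
    qed
    ultimately show ?thesis using corr[OF that] \<open>root_of \<alpha> (i, j) \<in> D\<close> by simp
  qed
  have mem: "(i, j) \<in> R \<longleftrightarrow> root_of \<alpha> (i, j) \<in> D" if "i \<in> ?X" "j \<in> ?X" "i \<noteq> j" for i j
  proof (cases "i < j")
    case True
    with up[OF that(1,2)] show ?thesis by simp
  next
    case False
    with up[OF that(2,1)] \<open>i \<noteq> j\<close> show ?thesis by simp
  qed
  show ?thesis
  proof
    show "D \<subseteq> root_of \<alpha> ` (R - Id)"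
    proof
      fix v assume v: "v \<in> D"
      then have "v \<in> root_of \<alpha> ` (?X \<times> ?X - Id)" using D(2) unfolding roots_eq by (rule subsetD[rotated])
      then obtain r where "r \<in> ?X \<times> ?X - Id" "v = root_of \<alpha> r" by (elim imageE)
      then obtain i j where "(i, j) \<in> ?X \<times> ?X - Id" "v = root_of \<alpha> (i, j)" by (cases r) simp
      with v mem[of i j] show "v \<in> root_of \<alpha> ` (R - Id)" by auto
    qed
    show "root_of \<alpha> ` (R - Id) \<subseteq> D"
    proof
      fix v assume "v \<in> root_of \<alpha> ` (R - Id)"
      then obtain i j where "(i, j) \<in> R" "i \<noteq> j" "v = root_of \<alpha> (i, j)" by auto
      with mem[of i j] R_sub show "v \<in> D" by auto
    qed
  qed
qed

theorem theorem4p5: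
  fixes n :: nat and \<alpha> :: "nat \<Rightarrow> 'v::real_vector" and \<Delta>2 :: "'v set"
    and F :: "nat \<Rightarrow> nat \<Rightarrow> nat" and R :: "nat rel" and P :: "nat set list"
  assumes "indexed_basis n \<alpha>"
    and "\<Delta>2 \<subseteq> simple_roots n \<alpha>"
    and "corresponds_to n \<alpha> (std_parabolic n \<alpha> \<Delta>2) F"
    and "total_preorder_of {1..n+1} F R"
    and "preorder_classes {1..n+1} R P"
  shows "card {B. biclosed_in (roots n \<alpha>) (std_parabolic n \<alpha> \<Delta>2) B} =
    (\<Sum>P' \<in> refinements {1..n+1} P. fact (card P') * 2 ^ num_nonsingleton P')"
proof -
  interpret finite_total_preorder "{1..n+1}" R
    using assms(4) by unfold_locales (simp_all add: total_preorder_of_def)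
  have "std_parabolic n \<alpha> \<Delta>2 = root_of \<alpha> ` (R - Id)"
    using assms(1) _ _ assms(3,4)
    by (rule parabolic_eq_image) (auto simp: std_parabolic_def roots_def)
  then have "card {B. biclosed_in (roots n \<alpha>) (std_parabolic n \<alpha> \<Delta>2) B} = card {T. biclosed_rel R T}"
    using card_biclosed_in[OF assms(1) R_sub] by simp
  also have "\<dots> = (\<Sum>Q\<in>fine_partitions {1..n+1} R. fact (card Q) * 2 ^ num_nonsingleton Q)"
    by (rule card_biclosed_rel)
  also have "fine_partitions {1..n+1} R = refinements {1..n+1} P"
    using assms(5) refinements_subset_fine fine_subset_refinements
    unfolding preorder_classes_def by blast
  finally show ?thesis .
qed

end
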